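(* The family of PP-rich subsets of $\mathbb{N}$ is strongly partition regular: whenever $A\subseteq\mathbb{N}$ is PP-rich and $A=A_1\cup\cdots\cup A_r$ for some $r\in\mathbb{N}$, at least one $A_i$ is PP-rich.
   Context: $\mathbb{P}$ denotes the set of polynomials with integer coefficients which vanish at $0$ and map $\mathbb{N}$ into $\mathbb{N}$. A set $A\subseteq\mathbb{N}$ is PP-rich if for every finite $F\subseteq\mathbb{P}$ there exist $a,x\in\mathbb{N}$ such that $a+P(x)\in A$ for all $P\in F$. *)

theory Defs
  imports "HOL-Computational_Algebra.Polynomial"
begin

text \<open>
  The set of natural numbers is taken to be the positive integers throughout. If 0 were allowed,
  the choice \<open>x = 0\<close> would make every nonempty set PP-rich.
\<close>

abbreviation pos_nats :: "nat set" where
  "pos_nats \<equiv> {1..}"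

definition PP :: "int poly set" where
  "PP = {p. poly p 0 = 0 \<and> (\<forall>n\<in>pos_nats. poly p (int n) \<in> int ` pos_nats)}"

definition PP_rich :: "nat set \<Rightarrow> bool" where
  "PP_rich A \<longleftrightarrow> A \<subseteq> pos_nats \<and>
     (\<forall>F. finite F \<and> F \<subseteq> PP \<longrightarrow>
        (\<exists>a\<in>pos_nats. \<exists>x\<in>pos_nats. \<forall>P\<in>F. int a + poly P (int x) \<in> int ` A))"

definition strongly_partition_regular :: "'a set set \<Rightarrow> bool" where
  "strongly_partition_regular \<F> \<longleftrightarrow>
     (\<forall>A\<in>\<F>. \<forall>r\<in>pos_nats. \<forall>B :: nat \<Rightarrow> 'a set.
        A = (\<Union>i\<in>{1..r}. B i) \<longrightarrow> (\<exists>i\<in>{1..r}. B i \<in> \<F>))"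

end

theory Submission
  imports Defs "HOL-Library.FuncSet" "HOL-Library.Multiset_Order"
begin

text \<open>
  The engine is a polynomial van der Waerden theorem in an integral domain, proved by colour
  focusing and PET induction. It is applied to the ring of integer polynomials itself, where
  \<open>n \<mapsto> P(n x)\<close> is a polynomial in \<open>n\<close> with coefficients in that ring: every finite colouring
  of polynomials has a monochromatic pattern \<open>{Q + P(n x) | P \<in> F}\<close> with \<open>Q\<close> in a fixed finite
  set. After adding a large fixed element of \<open>PP\<close> this pattern consists of elements of \<open>PP\<close>, so
  richness of \<open>A\<close> realises all possible patterns at some \<open>a, x\<close>; colouring a polynomial by the
  part of \<open>A\<close> containing its realisation shows that one part contains \<open>b + P(n x)\<close> for \<open>P \<in> F\<close>,
  where \<open>F\<close> collects counterexamples for all the parts.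
\<close>

section \<open>Monochromatic patterns, focusing and the PET weight\<close>

definition mono_pattern ::
    "'a::comm_ring_1 poly set \<Rightarrow> 'a set \<Rightarrow> nat \<Rightarrow> ('a \<Rightarrow> nat) \<Rightarrow> bool" where
  "mono_pattern F S N c \<longleftrightarrow>
     (\<exists>a\<in>S. \<exists>n\<in>{1..N}. \<forall>p\<in>F. c (a + poly p (of_nat n)) = c a)"

text \<open>\<open>S\<close> and \<open>N\<close> are chosen before \<open>c\<close>; this
  uniformity keeps the window finite whose translates are coloured in the focusing step.\<close>

definition poly_vdw :: "'a::comm_ring_1 poly set \<Rightarrow> bool" where
  "poly_vdw F \<longleftrightarrow>
     (\<forall>r. \<exists>S N. finite S \<and> (\<forall>c. range c \<subseteq> {..<r} \<longrightarrow> mono_pattern F S N c))"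

text \<open>\<open>k\<close> families with common focus \<open>a\<close>, each of one colour.
  Collecting the colours in \<open>C\<close> turns their distinctness into a cardinality.\<close>

definition focused_patterns ::
    "'a::comm_ring_1 poly set \<Rightarrow> nat \<Rightarrow> 'a set \<Rightarrow> nat \<Rightarrow> ('a \<Rightarrow> nat) \<Rightarrow> bool" where
  "focused_patterns F k S N c \<longleftrightarrow>
     (\<exists>a\<in>S. \<exists>C. finite C \<and> card C = k \<and> c a \<notin> C \<and>
        (\<forall>\<kappa>\<in>C. \<exists>d\<in>{1..N}. \<forall>p\<in>F. c (a + poly p (of_nat d)) = \<kappa>))"

text \<open>Nonconstant polynomials with equal signature differ by one of smaller degree. Counting
  signatures rather than polynomials keeps the shifts by many \<open>d\<close> from adding weight in
  high degrees.\<close>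

definition poly_sig :: "'a::zero poly \<Rightarrow> nat \<times> 'a" where
  "poly_sig p = (degree p, lead_coeff p)"

text \<open>
  Weights are compared in the multiset order: if \<open>p0\<close> has minimal degree, passing to differences
  with \<open>p0\<close> removes one signature of that degree and creates new ones in lower degrees only.
\<close>

definition pet_weight :: "'a::zero poly set \<Rightarrow> nat multiset" where
  "pet_weight F = image_mset fst (mset_set (poly_sig ` (F - {0})))"

text \<open>
  This is the error made in \<open>a + p(d)\<close> when the focus moves from \<open>a\<close> to \<open>a - p0(n)\<close> and the
  difference from \<open>d\<close> to \<open>d + n\<close>.
\<close>

definition pet_step :: "'a::comm_ring_1 poly \<Rightarrow> nat \<Rightarrow> 'a poly \<Rightarrow> 'a poly" where
  "pet_step p0 d p = pcompose p [:of_nat d, 1:] - [:poly p (of_nat d):] - p0"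

section \<open>PET induction: differences lower the weight\<close>

lemma poly_vdwE:
  assumes "poly_vdw F"
  obtains S N where "finite S" "\<And>c. range c \<subseteq> {..<r} \<Longrightarrow> mono_pattern F S N c"
proof -
  from spec[OF assms[unfolded poly_vdw_def], of r]
  obtain S N where "finite S" and *: "\<forall>c. range c \<subseteq> {..<r} \<longrightarrow> mono_pattern F S N c"
    by (elim exE conjE) (rule that)
  show thesis
    by (rule that[of S N, OF \<open>finite S\<close>]) (use * in simp)
qed

lemma poly_pet_step:
  "poly (pet_step p0 d p) x = poly p (x + of_nat d) - poly p (of_nat d) - poly p0 x"
  by (simp add: pet_step_def poly_pcompose add.commute)

text \<open>A shift of the argument keeps the leading term, and subtracting a constant affects only
  coefficient 0. So \<open>p0\<close> can disturb the leading term only when the degrees agree, and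
  equal leading terms then cancel.\<close>

lemma poly_sig_pet_step:
  fixes p p0 :: "'a::idom poly"
  assumes "p0 \<noteq> 0" "poly p0 0 = 0" "degree p0 \<le> degree p" "pet_step p0 d p \<noteq> 0"
  defines "q \<equiv> pet_step p0 d p"
  shows "degree q < degree p0 \<or>
    (degree p = degree p0 \<and> poly_sig p \<noteq> poly_sig p0
       \<and> poly_sig q = (degree p0, lead_coeff p - lead_coeff p0)) \<or>
    (degree p > degree p0 \<and> poly_sig q = poly_sig p)"
proof -
  have D: "degree p0 > 0"
  proof (rule gr_zeroI)
    assume "degree p0 = 0"
    then obtain a where "p0 = [:a:]" by (rule degree_eq_zeroE)
    then show False using assms(1,2) by simp
  qed
  define s where "s = pcompose p [:of_nat d, 1:]"
  have ds: "degree s = degree p"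
    by (simp add: s_def degree_pcompose)
  have ls: "coeff s (degree p) = lead_coeff p"
    using lead_coeff_comp[of "[:of_nat d, 1:]" p] ds by (simp add: s_def)
  have cq: "coeff q i = coeff s i - coeff p0 i" if "i > 0" for i
    using that by (simp add: q_def pet_step_def s_def coeff_pCons split: nat.split)
  have dq: "degree q \<le> degree p"
    by (rule degree_le) (use D assms(3) ds in \<open>auto simp: cq coeff_eq_0\<close>)
  show ?thesis
  proof (cases "degree p = degree p0")
    case True
    then have c: "coeff q (degree p0) = lead_coeff p - lead_coeff p0"
      using D ls by (simp add: cq)
    show ?thesis
    proof (cases "degree q < degree p0")
      case False
      with dq True have e: "degree q = degree p0" by simp
      with c have l: "lead_coeff q = lead_coeff p - lead_coeff p0" by simp
      moreover have "lead_coeff q \<noteq> 0"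
        using assms(4) by (simp add: q_def)
      ultimately show ?thesis using True e by (auto simp: poly_sig_def)
    qed simp
  next
    case False
    with assms(3) have lt: "degree p0 < degree p" by simp
    then have c: "coeff q (degree p) = lead_coeff p"
      using ls by (simp add: cq coeff_eq_0)
    then have "coeff q (degree p) \<noteq> 0" using lt by auto
    then have "degree q = degree p" using dq le_degree by (metis le_antisym)
    then show ?thesis using c lt by (simp add: poly_sig_def)
  qed
qed

lemma pet_weight_pet_step_less:
  fixes F G :: "'a::idom poly set"
  assumes fin: "finite F" "finite G" and p0: "p0 \<in> F" "poly p0 0 = 0" and nz: "0 \<notin> F"
    and min: "\<And>p. p \<in> F \<Longrightarrow> degree p0 \<le> degree p"
    and G: "\<And>q. q \<in> G \<Longrightarrow> \<exists>p\<in>F. \<exists>d. q = pet_step p0 d p"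
  shows "pet_weight G < pet_weight F"
proof -
  \<comment> \<open>The effect of \<open>pet_step p0 d\<close> on a signature whose degree survives.
    It is injective and preserves degrees, so it leaves weights unchanged.\<close>
  define \<phi> where "\<phi> x = (if fst x = degree p0 then (fst x, snd x - lead_coeff p0) else x)"
    for x :: "nat \<times> 'a"
  have fst_\<phi>: "fst (\<phi> x) = fst x" for x by (simp add: \<phi>_def)
  have inj_\<phi>: "inj_on \<phi> A" for A
    by (rule inj_onI) (auto simp: \<phi>_def prod_eq_iff split: if_splits)
  define L where "L = poly_sig ` F - {poly_sig p0}"
  define M where "M = poly_sig ` (G - {0})"
  define K where "K = {x \<in> M. fst x < degree p0}"
  have fins: "finite L" "finite M" "finite K"
    using fin by (auto simp: L_def M_def K_def)
  have "p0 \<noteq> 0" using p0 nz by auto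
  have "M \<subseteq> \<phi> ` L \<union> K"
  proof
    fix x assume "x \<in> M"
    then obtain q where q: "q \<in> G" "q \<noteq> 0" "x = poly_sig q" by (auto simp: M_def)
    then obtain p d where p: "p \<in> F" "q = pet_step p0 d p" using G by blast
    consider "degree q < degree p0"
      | "degree p = degree p0" "poly_sig p \<noteq> poly_sig p0"
        "poly_sig q = (degree p0, lead_coeff p - lead_coeff p0)"
      | "degree p > degree p0" "poly_sig q = poly_sig p"
      using poly_sig_pet_step[of p0 p d] \<open>p0 \<noteq> 0\<close> p0(2) min p q by blast
    then show "x \<in> \<phi> ` L \<union> K"
    proof cases
      case 1
      then show ?thesis using q \<open>x \<in> M\<close> by (simp add: K_def poly_sig_def)
    next
      case 2
      then have "x = \<phi> (poly_sig p)" "poly_sig p \<in> L"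
        using q p imageI[OF p(1), of poly_sig] by (auto simp: \<phi>_def poly_sig_def L_def)
      then show ?thesis by blast
    next
      case 3
      then have "x = \<phi> (poly_sig p)" "poly_sig p \<in> L"
        using q p imageI[OF p(1), of poly_sig] by (auto simp: \<phi>_def poly_sig_def L_def)
      then show ?thesis by blast
    qed
  qed
  then have "mset_set M \<subseteq># mset_set (\<phi> ` L \<union> K)"
    using fins by (subst subset_imp_msubset_mset_set) auto
  also have "\<dots> \<subseteq># mset_set (\<phi> ` L) + mset_set K"
    using fins by (auto simp: subseteq_mset_def count_mset_set')
  finally have "image_mset fst (mset_set M) \<subseteq># image_mset fst (mset_set (\<phi> ` L) + mset_set K)"
    by (rule image_mset_subseteq_mono)
  also have "image_mset fst (mset_set (\<phi> ` L)) = image_mset fst (mset_set L)"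
    by (simp add: image_mset_mset_set[OF inj_\<phi>, symmetric] multiset.map_comp o_def fst_\<phi>)
  then have "image_mset fst (mset_set (\<phi> ` L) + mset_set K)
      = image_mset fst (mset_set L) + image_mset fst (mset_set K)" by simp
  finally have "pet_weight G \<le> image_mset fst (mset_set L) + image_mset fst (mset_set K)"
    unfolding pet_weight_def M_def by (rule subset_eq_imp_le_multiset)
  \<comment> \<open>The signature of \<open>p0\<close> is lost; its degree dominates all of
    \<open>K\<close>, however large \<open>K\<close> is.\<close>
  also have "\<dots> < image_mset fst (mset_set L) + {#degree p0#}"
    unfolding less_multiset_def
    by (rule one_step_implies_multp) (use fins in \<open>auto simp: K_def\<close>)
  also have "\<dots> = pet_weight F"
  proof -
    have "poly_sig ` (F - {0}) = insert (poly_sig p0) L"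
      using p0 nz by (auto simp: L_def)
    moreover have "poly_sig p0 \<notin> L" by (simp add: L_def)
    ultimately show ?thesis
      using fins by (simp add: pet_weight_def poly_sig_def)
  qed
  finally show ?thesis .
qed

section \<open>Colour focusing and the polynomial van der Waerden theorem\<close>

text \<open>
  A product colouring: \<open>f\<close> codes the colour pattern of the translate \<open>x + T\<close>, and the number of
  patterns is bounded independently of \<open>c\<close>.
\<close>

lemma poly_vdw_pattern:
  fixes F :: "'a::comm_ring_1 poly set"
  assumes "poly_vdw F" "finite T"
  obtains S N where "finite S"
    and "\<And>c. range c \<subseteq> {..<r::nat} \<Longrightarrow>
      \<exists>b\<in>S. \<exists>n\<in>{1..N}. \<forall>p\<in>F. \<forall>t\<in>T. c (b + poly p (of_nat n) + t) = c (b + t)"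
proof -
  define X where "X = T \<rightarrow>\<^sub>E {..<r}"
  have "finite X" using assms(2) by (auto simp: X_def intro: finite_PiE)
  from finite_imp_inj_to_nat_seg[OF this]
  obtain f :: "('a \<Rightarrow> nat) \<Rightarrow> nat" and m where f: "f ` X = {i. i < m}" "inj_on f X"
    by (elim exE conjE) (rule that)
  obtain S N where S: "finite S"
    and SN: "\<And>c. range c \<subseteq> {..<m} \<Longrightarrow> mono_pattern F S N c"
    by (rule poly_vdwE[OF assms(1), where r = m]) (rule that)
  have "\<exists>b\<in>S. \<exists>n\<in>{1..N}. \<forall>p\<in>F. \<forall>t\<in>T. c (b + poly p (of_nat n) + t) = c (b + t)"
    if c: "range c \<subseteq> {..<r}" for c :: "'a \<Rightarrow> nat"
  proof -
    define g where "g x = restrict (\<lambda>t. c (x + t)) T" for x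
    have gX: "g x \<in> X" for x using c by (auto simp: g_def X_def)
    have "range (\<lambda>x. f (g x)) \<subseteq> {..<m}" using gX f(1) by auto
    from SN[OF this] obtain b n where bn: "b \<in> S" "n \<in> {1..N}"
      "\<forall>p\<in>F. f (g (b + poly p (of_nat n))) = f (g b)" unfolding mono_pattern_def by blast
    have "c (b + poly p (of_nat n) + t) = c (b + t)" if "p \<in> F" "t \<in> T" for p t
    proof -
      have "g (b + poly p (of_nat n)) = g b"
        using bn(3) that(1) inj_onD[OF f(2)] gX by blast
      then have "g (b + poly p (of_nat n)) t = g b t" by simp
      then show ?thesis using that(2) by (simp add: g_def)
    qed
    then show ?thesis by (intro bexI[OF _ bn(1)] bexI[OF _ bn(2)] ballI) simp
  qed
  then show thesis by (rule that[OF S])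
qed

text \<open>With q = \<open>pet_step p0 d p\<close>, p(n + d) - p0(n) = q(n) + p(d). Hence a window
  whose colours repeat under all shifts q(n) lets the focus move by -p0(n) while old families keep
  their colours.\<close>

lemma poly_vdw_focus:
  fixes F :: "'a::comm_ring_1 poly set"
  assumes fin: "finite F"
    and IH: "\<And>N. poly_vdw ((\<lambda>(d, p). pet_step p0 d p) ` ({0..N} \<times> F))"
    and z: "\<forall>p\<in>F. poly p 0 = 0"
  shows "\<exists>S N. finite S \<and>
    (\<forall>c. range c \<subseteq> {..<r} \<longrightarrow> mono_pattern F S N c \<or> focused_patterns F k S N c)"
proof (induction k)
  case 0
  have "focused_patterns F 0 {0} 0 c" for c
    by (auto simp: focused_patterns_def intro!: exI[of _ "{}"])
  then show ?case by (intro exI[of _ "{0}"] exI[of _ 0]) simp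
next
  case (Suc k)
  then obtain S N where S: "finite S"
    and SN: "\<forall>c. range c \<subseteq> {..<r} \<longrightarrow> mono_pattern F S N c \<or> focused_patterns F k S N c"
    by (elim exE conjE) (rule that)
  \<comment> \<open>The range of \<open>d\<close> starts at 0 because d = 0 yields the new family,
    whose colour is that of the old focus.\<close>
  define T where "T = (\<lambda>(a, p, d). a + poly p (of_nat d)) ` (S \<times> F \<times> {0..N})"
  have "finite T" using S fin by (simp add: T_def)
  obtain S' N' where S': "finite S'" and SN': "\<And>c. range c \<subseteq> {..<r} \<Longrightarrow>
      \<exists>b\<in>S'. \<exists>n\<in>{1..N'}. \<forall>q\<in>(\<lambda>(d, p). pet_step p0 d p) ` ({0..N} \<times> F).
         \<forall>t\<in>T. c (b + poly q (of_nat n) + t) = c (b + t)"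
    by (rule poly_vdw_pattern[OF IH \<open>finite T\<close>, where r = r]) (rule that)
  \<comment> \<open>Base points of patterns inside a translate by \<open>b\<close>, and the moved
    foci.\<close>
  define S2 where "S2 = (\<lambda>(b, a). b + a) ` (S' \<times> S)
     \<union> (\<lambda>(b, a, n). b + a - poly p0 (of_nat n)) ` (S' \<times> S \<times> {1..N'})"
  have fin2: "finite S2" using S S' by (simp add: S2_def)
  show ?case
  proof (intro exI conjI allI impI)
    show "finite S2" by (rule fin2)
    fix c :: "'a \<Rightarrow> nat" assume c: "range c \<subseteq> {..<r}"
    from SN'[OF c] obtain b n where b: "b \<in> S'" and n: "n \<in> {1..N'}"
      and col: "\<And>d p t. d \<le> N \<Longrightarrow> p \<in> F \<Longrightarrow> t \<in> T \<Longrightarrow>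
        c (b + poly (pet_step p0 d p) (of_nat n) + t) = c (b + t)"
    proof (elim bexE)
      fix b n assume bn: "b \<in> S'" "n \<in> {1..N'}"
        and H: "\<forall>q\<in>(\<lambda>(d, p). pet_step p0 d p) ` ({0..N} \<times> F).
          \<forall>t\<in>T. c (b + poly q (of_nat n) + t) = c (b + t)"
      have "pet_step p0 d p \<in> (\<lambda>(d, p). pet_step p0 d p) ` ({0..N} \<times> F)"
        if "d \<le> N" "p \<in> F" for d p using that by auto
      with H have "c (b + poly (pet_step p0 d p) (of_nat n) + t) = c (b + t)"
        if "d \<le> N" "p \<in> F" "t \<in> T" for d p t using that by blast
      with bn show ?thesis by (rule that)
    qed
    have "range (\<lambda>x. c (b + x)) \<subseteq> {..<r}" using c by auto
    from SN[rule_format, OF this]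
    show "mono_pattern F S2 (N + N') c \<or> focused_patterns F (Suc k) S2 (N + N') c"
    proof
      assume "mono_pattern F S N (\<lambda>x. c (b + x))"
      then obtain a m where mono: "a \<in> S" "m \<in> {1..N}"
        "\<forall>p\<in>F. c (b + (a + poly p (of_nat m))) = c (b + a)"
        unfolding mono_pattern_def by (elim bexE) (rule that)
      have "b + a \<in> S2"
        unfolding S2_def by (rule UnI1, rule image_eqI[of _ _ "(b, a)"]) (simp_all add: b mono)
      moreover have "m \<in> {1..N + N'}" using mono by auto
      moreover have "\<forall>p\<in>F. c (b + a + poly p (of_nat m)) = c (b + a)"
        using mono(3) by (simp add: add.assoc)
      ultimately have "mono_pattern F S2 (N + N') c" unfolding mono_pattern_def by blast
      then show ?thesis ..
    next
      assume "focused_patterns F k S N (\<lambda>x. c (b + x))"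
      then obtain a C where focus: "a \<in> S" "finite C" "card C = k" "c (b + a) \<notin> C"
        "\<forall>\<kappa>\<in>C. \<exists>d\<in>{1..N}. \<forall>p\<in>F. c (b + (a + poly p (of_nat d))) = \<kappa>"
        unfolding focused_patterns_def by (elim bexE exE conjE) (rule that)
      define a' where "a' = b + a - poly p0 (of_nat n)"
      have a': "a' \<in> S2"
        unfolding S2_def a'_def
        by (rule UnI2, rule image_eqI[of _ _ "(b, a, n)"]) (use b focus(1) n in simp_all)
      have key: "c (a' + poly p (of_nat (n + d))) = c (b + (a + poly p (of_nat d)))"
        if "d \<le> N" "p \<in> F" for d p
      proof -
        have "a + poly p (of_nat d) \<in> T"
          unfolding T_def by (rule image_eqI[of _ _ "(a, p, d)"]) (use focus(1) that in simp_all)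
        from col[OF that this] show ?thesis
          by (simp add: poly_pet_step a'_def algebra_simps)
      qed
      define C' where "C' = insert (c (b + a)) C"
      have C': "finite C'" "card C' = Suc k" using focus by (auto simp: C'_def)
      have foc: "\<exists>d\<in>{1..N + N'}. \<forall>p\<in>F. c (a' + poly p (of_nat d)) = \<kappa>" if "\<kappa> \<in> C'" for \<kappa>
      proof (cases "\<kappa> = c (b + a)")
        case True
        then have "\<forall>p\<in>F. c (a' + poly p (of_nat n)) = \<kappa>"
          using key[of 0] z by simp
        moreover have "n \<in> {1..N + N'}" using n by simp
        ultimately show ?thesis by blast
      next
        case False
        with that have "\<kappa> \<in> C" by (simp add: C'_def)
        with focus(5) obtain d where d: "d \<in> {1..N}"
          "\<forall>p\<in>F. c (b + (a + poly p (of_nat d))) = \<kappa>" by blast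
        then have "\<forall>p\<in>F. c (a' + poly p (of_nat (n + d))) = \<kappa>" using key by simp
        moreover have "n + d \<in> {1..N + N'}" using n d by auto
        ultimately show ?thesis by blast
      qed
      show ?thesis
      \<comment> \<open>If the new focus has one of the collected colours, it completes that family
        to a monochromatic pattern; otherwise there are k + 1 families.\<close>
      proof (cases "c a' \<in> C'")
        case True
        with foc obtain d where "d \<in> {1..N + N'}" "\<forall>p\<in>F. c (a' + poly p (of_nat d)) = c a'"
          by blast
        with a' have "mono_pattern F S2 (N + N') c" unfolding mono_pattern_def by blast
        then show ?thesis ..
      next
        case False
        then have "focused_patterns F (Suc k) S2 (N + N') c"
          unfolding focused_patterns_def using foc C' by (intro bexI[OF _ a'] exI[of _ C']) simp
        then show ?thesis ..
      qed
    qed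
  qed
qed

text \<open>Well-founded induction on \<open>pet_weight\<close>. Focusing with k = r suffices: r
  family colours and a further colour at the focus do not fit into r colours.\<close>

theorem polynomial_van_der_Waerden:
  fixes F :: "'a::idom poly set"
  assumes "finite F" "\<forall>p\<in>F. poly p 0 = 0"
  shows "poly_vdw F"
  using assms
proof (induction "pet_weight F" arbitrary: F rule: less_induct)
  case less
  \<comment> \<open>The zero polynomial imposes no condition, but it would spoil the choice of
    \<open>p0\<close> by minimal degree.\<close>
  define F0 where "F0 = F - {0}"
  have wF0: "pet_weight F0 = pet_weight F" by (simp add: F0_def pet_weight_def)
  have F0: "finite F0" "0 \<notin> F0" "\<forall>p\<in>F0. poly p 0 = 0"
    using less.prems by (auto simp: F0_def)
  have "poly_vdw F0"
  proof (cases "F0 = {}")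
    case True
    have "mono_pattern F0 {0} 1 c" for c by (simp add: True mono_pattern_def)
    then show ?thesis unfolding poly_vdw_def by (intro allI exI[of _ "{0}"] exI[of _ 1]) simp
  next
    case False
    then obtain p where "p \<in> F0" by blast
    from ex_has_least_nat[of "\<lambda>p. p \<in> F0", OF this, of degree]
    obtain p0 where p0: "p0 \<in> F0" "\<And>p. p \<in> F0 \<Longrightarrow> degree p0 \<le> degree p" by blast
    have IH: "poly_vdw ((\<lambda>(d, p). pet_step p0 d p) ` ({0..N} \<times> F0))" (is "poly_vdw ?G") for N
    proof (rule less.hyps)
      show "finite ?G" using F0 by simp
      then show "pet_weight ?G < pet_weight F"
        unfolding wF0[symmetric] using F0 p0
        by (intro pet_weight_pet_step_less[of _ _ p0]) auto
      show "\<forall>q\<in>?G. poly q 0 = 0"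
        using F0 p0 by (auto simp: poly_pet_step)
    qed
    show ?thesis unfolding poly_vdw_def
    proof
      fix r :: nat
      from poly_vdw_focus[OF F0(1) IH F0(3), of r r] obtain S N where S: "finite S" and
        SN: "\<forall>c. range c \<subseteq> {..<r} \<longrightarrow> mono_pattern F0 S N c \<or> focused_patterns F0 r S N c"
        by (elim exE conjE) (rule that)
      have "mono_pattern F0 S N c" if c: "range c \<subseteq> {..<r}" for c
      proof (rule ccontr)
        assume "\<not> ?thesis"
        with SN[rule_format, OF c] obtain a C where C: "finite C" "card C = r" "c a \<notin> C"
          "\<forall>\<kappa>\<in>C. \<exists>d\<in>{1..N}. \<forall>p\<in>F0. c (a + poly p (of_nat d)) = \<kappa>"
          unfolding focused_patterns_def by (elim disjE bexE exE conjE) (simp, rule that)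
        \<comment> \<open>Here \<open>p0\<close> witnesses that each colour is attained; for empty
          \<open>F0\<close> the set \<open>C\<close> would be arbitrary.\<close>
        have "C \<subseteq> range c"
        proof
          fix \<kappa> assume "\<kappa> \<in> C"
          with C(4) obtain d where "\<forall>p\<in>F0. c (a + poly p (of_nat d)) = \<kappa>" by blast
          then have "\<kappa> = c (a + poly p0 (of_nat d))" using p0(1) by simp
          then show "\<kappa> \<in> range c" by simp
        qed
        then have "insert (c a) C \<subseteq> {..<r}" using c by auto
        from card_mono[OF _ this] C show False by simp
      qed
      with S show "\<exists>S N. finite S \<and>
        (\<forall>c. range c \<subseteq> {..<r} \<longrightarrow> mono_pattern F0 S N c)"
        by (intro exI[of _ S] exI[of _ N]) simp
    qed
  qed
  moreover have "(\<forall>p\<in>F0. c (a + poly p (of_nat n)) = c a) \<longleftrightarrow>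
      (\<forall>p\<in>F. c (a + poly p (of_nat n)) = c a)" for c :: "'a \<Rightarrow> nat" and a n
    by (auto simp: F0_def)
  ultimately show ?case by (simp only: poly_vdw_def mono_pattern_def simp_thms)
qed

section \<open>Patterns of dilates in the ring of integer polynomials\<close>

corollary polynomial_van_der_Waerden_dilates:
  fixes F :: "int poly set" and r :: nat
  assumes "finite F" "\<forall>P\<in>F. poly P 0 = 0"
  obtains S where "finite S" "\<And>Q. Q \<in> S \<Longrightarrow> poly Q 0 = 0"
    and "\<And>c. range c \<subseteq> {..<r} \<Longrightarrow>
      \<exists>Q n. n \<ge> 1 \<and> Q \<in> S \<and> (\<forall>P\<in>F. Q + pcompose P [:0, of_nat n:] \<in> S
        \<and> c (Q + pcompose P [:0, of_nat n:]) = c Q)"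
proof -
  \<comment> \<open>P(x y) as a polynomial in y with coefficients in Z[x].\<close>
  define lift :: "int poly \<Rightarrow> int poly poly"
    where "lift P = pcompose (map_poly (\<lambda>c. [:c:]) P) [:0, [:0, 1:]:]" for P
  have lift: "poly (lift P) (of_nat n) = pcompose P [:0, of_nat n:]" for P n
    by (simp add: lift_def poly_pcompose of_nat_poly flip: pcompose_altdef)
  define E where "E n P = pcompose P [:0, of_nat n:]" for n :: nat and P :: "int poly"
  have E0: "poly (E n P) 0 = poly P 0" for n P
    by (simp add: E_def poly_pcompose)
  have "poly_vdw (lift ` F)"
  proof (rule polynomial_van_der_Waerden)
    show "finite (lift ` F)" using assms by simp
    show "\<forall>p\<in>lift ` F. poly p 0 = 0"
    proof
      fix p assume "p \<in> lift ` F"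
      then obtain P where P: "P \<in> F" "p = lift P" by blast
      have "poly p 0 = pcompose P 0" using lift[of P 0] P by simp
      then show "poly p 0 = 0"
        using bspec[OF assms(2) P(1)] by (simp add: pcompose_0' poly_0_coeff_0)
    qed
  qed
  then obtain S N where S: "finite S"
    and mono: "\<And>c. range c \<subseteq> {..<r} \<Longrightarrow> mono_pattern (lift ` F) S N c"
    by (rule poly_vdwE[where r = r]) (rule that)
  have SN: "\<exists>a\<in>S. \<exists>n\<in>{1..N}. \<forall>P\<in>F. c (a + E n P) = c a"
    if "range c \<subseteq> {..<r}" for c :: "int poly \<Rightarrow> nat"
    using mono[OF that] by (simp add: mono_pattern_def lift E_def)
  \<comment> \<open>Colouring through \<open>z\<close> removes the constant terms of the base points.\<close>
  define z where "z Q = Q - [:poly Q 0:]" for Q :: "int poly"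
  \<comment> \<open>Whole patterns are included, not just base points, so that only colours on a
    finite set matter.\<close>
  define S' where "S' = z ` S \<union> (\<lambda>(a, n, P). z a + E n P) ` (S \<times> {1..N} \<times> F)"
  show thesis
  proof (rule that)
    show "finite S'" using S assms by (simp add: S'_def)
    show "poly Q 0 = 0" if "Q \<in> S'" for Q
      using that assms(2) by (auto simp: S'_def z_def E0)
    fix c :: "int poly \<Rightarrow> nat" assume "range c \<subseteq> {..<r}"
    then have "range (\<lambda>Q. c (z Q)) \<subseteq> {..<r}" by auto
    from SN[OF this] obtain a n where an: "a \<in> S" "n \<in> {1..N}"
      "\<forall>P\<in>F. c (z (a + E n P)) = c (z a)" by blast
    have "z (a + E n P) = z a + E n P" if "P \<in> F" for P
      using bspec[OF assms(2) that] by (simp add: z_def E0)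
    moreover have "z a + E n P \<in> S'" if "P \<in> F" for P
      using an that by (force simp: S'_def)
    moreover have "z a \<in> S'" using an by (simp add: S'_def)
    ultimately have "n \<ge> 1 \<and> z a \<in> S' \<and> (\<forall>P\<in>F. z a + E n P \<in> S' \<and> c (z a + E n P) = c (z a))"
      using an by auto
    then show "\<exists>Q n. n \<ge> 1 \<and> Q \<in> S' \<and> (\<forall>P\<in>F. Q + pcompose P [:0, of_nat n:] \<in> S'
        \<and> c (Q + pcompose P [:0, of_nat n:]) = c Q)"
      unfolding E_def by blast
  qed
qed

section \<open>Translating finite sets of polynomials into \<open>PP\<close>\<close>

lemma PP_iff: "P \<in> PP \<longleftrightarrow> poly P 0 = 0 \<and> (\<forall>n\<ge>1. poly P (int n) \<ge> 1)"
proof -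
  have "int ` pos_nats = {1..}"
  proof (intro equalityI subsetI)
    fix x :: int assume "x \<in> {1..}"
    then have "x = int (nat x)" "nat x \<in> pos_nats" by auto
    then show "x \<in> int ` pos_nats" by blast
  qed auto
  then show ?thesis by (auto simp: PP_def)
qed

lemma PP_add: "P \<in> PP \<Longrightarrow> Q \<in> PP \<Longrightarrow> P + Q \<in> PP"
  unfolding PP_iff by fastforce

text \<open>Horner's scheme: a constant term |a| + 1 outweighs \<open>a\<close>, and the remaining
  multiples of n are nonnegative by induction.\<close>

lemma ex_positive_translate:
  fixes Q :: "int poly"
  shows "\<exists>T. \<forall>n::nat\<ge>1. poly T (int n) \<ge> 1 \<and> poly (T + Q) (int n) \<ge> 1"
proof (induction Q)
  case 0
  show ?case by (rule exI[of _ 1]) simp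
next
  case (pCons a Q)
  then obtain T where T: "\<And>n::nat. n \<ge> 1 \<Longrightarrow> poly T (int n) \<ge> 1"
    "\<And>n::nat. n \<ge> 1 \<Longrightarrow> poly (T + Q) (int n) \<ge> 1" by blast
  have "poly (pCons (\<bar>a\<bar> + 1) T) (int n) \<ge> 1 \<and> poly (pCons (\<bar>a\<bar> + 1) T + pCons a Q) (int n) \<ge> 1"
    if "n \<ge> 1" for n :: nat
  proof -
    have "0 \<le> int n * poly T (int n)" "0 \<le> int n * poly (T + Q) (int n)"
      using T[OF that] by auto
    then show ?thesis by (auto simp: algebra_simps)
  qed
  then show ?case by blast
qed

lemma ex_PP_translate:
  assumes "finite S" "\<And>Q. Q \<in> S \<Longrightarrow> poly Q 0 = 0"
  shows "\<exists>T\<in>PP. \<forall>Q\<in>S. T + Q \<in> PP"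
  using assms
proof (induction S rule: finite_induct)
  case empty
  have "[:0, 1:] \<in> PP" by (simp add: PP_iff)
  then show ?case by blast
next
  case (insert Q S)
  then obtain T where T: "T \<in> PP" "\<And>Q. Q \<in> S \<Longrightarrow> T + Q \<in> PP" by auto
  obtain R where R: "Q = pCons 0 R"
    using insert.prems[of Q] by (cases Q) auto
  obtain U where U: "\<And>n::nat. n \<ge> 1 \<Longrightarrow> poly U (int n) \<ge> 1 \<and> poly (U + R) (int n) \<ge> 1"
    using ex_positive_translate by blast
  have mult_ge_1: "x * y \<ge> 1" if "x \<ge> 1" "y \<ge> 1" for x y :: int
    using mult_mono[of 1 x 1 y] that by simp
  have V: "pCons 0 U \<in> PP" and VQ: "pCons 0 U + Q \<in> PP"
    using U by (auto simp: PP_iff R intro!: mult_ge_1)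
  \<comment> \<open>For the new \<open>Q\<close>, group as (xU + Q) + T; for old elements, as xU +
    (T + Q').\<close>
  have "pCons 0 U + T + Q' \<in> PP" if "Q' \<in> insert Q S" for Q'
    using that PP_add[OF VQ T(1)] PP_add[OF V T(2)] by (auto simp: ac_simps)
  then show ?case using PP_add[OF V T(1)] by blast
qed

section \<open>Partition regularity of PP-richness\<close>

theorem theorem4p3: "strongly_partition_regular {A. PP_rich A}"
  unfolding strongly_partition_regular_def mem_Collect_eq
proof (intro ballI allI impI, rule ccontr)
  fix A r and B :: "nat \<Rightarrow> nat set"
  assume "A \<in> {A. PP_rich A}" and A: "A = (\<Union>i\<in>{1..r}. B i)"
  then have rich: "PP_rich A" by simp
  then have pos: "A \<subseteq> pos_nats" by (simp add: PP_rich_def)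
  assume not_rich: "\<not> (\<exists>i\<in>{1..r}. PP_rich (B i))"
  have "\<forall>i\<in>{1..r}. \<exists>F. (finite F \<and> F \<subseteq> PP) \<and>
      \<not> (\<exists>a\<in>pos_nats. \<exists>x\<in>pos_nats. \<forall>P\<in>F. int a + poly P (int x) \<in> int ` B i)"
  proof
    fix i assume i: "i \<in> {1..r}"
    then have "\<not> PP_rich (B i)" "B i \<subseteq> pos_nats" using not_rich pos A by blast+
    then show "\<exists>F. (finite F \<and> F \<subseteq> PP) \<and>
      \<not> (\<exists>a\<in>pos_nats. \<exists>x\<in>pos_nats. \<forall>P\<in>F. int a + poly P (int x) \<in> int ` B i)"
      unfolding PP_rich_def by (simp only: not_all not_imp simp_thms)
  qed
  from bchoice[OF this] obtain F where F': "\<forall>i\<in>{1..r}. (finite (F i) \<and> F i \<subseteq> PP) \<and>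
      \<not> (\<exists>a\<in>pos_nats. \<exists>x\<in>pos_nats. \<forall>P\<in>F i. int a + poly P (int x) \<in> int ` B i)"
    by (elim exE) (rule that)
  then have F: "finite (F i)" "F i \<subseteq> PP" if "i \<in> {1..r}" for i
    using that by simp_all
  have bad: "\<exists>P\<in>F i. int a + poly P (int x) \<notin> int ` B i"
    if "i \<in> {1..r}" "a \<in> pos_nats" "x \<in> pos_nats" for i a x
    using bspec[OF F' that(1)] that(2,3) by fast
  \<comment> \<open>One family defeating every part at once, since the part that wins is not known
    in advance.\<close>
  define G where "G = (\<Union>i\<in>{1..r}. F i)"
  have G: "finite G" "\<forall>P\<in>G. poly P 0 = 0"
  proof -
    show "finite G" using F by (simp add: G_def)
    have "G \<subseteq> PP" using F(2) unfolding G_def by blast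
    then show "\<forall>P\<in>G. poly P 0 = 0" using PP_iff by blast
  qed
  obtain S where S: "finite S" "\<And>Q. Q \<in> S \<Longrightarrow> poly Q 0 = 0"
    and mono: "\<And>c. range c \<subseteq> {..<Suc r} \<Longrightarrow>
      \<exists>Q n. n \<ge> 1 \<and> Q \<in> S \<and> (\<forall>P\<in>G. Q + pcompose P [:0, of_nat n:] \<in> S
        \<and> c (Q + pcompose P [:0, of_nat n:]) = c Q)"
    by (rule polynomial_van_der_Waerden_dilates[OF G, where r = "Suc r"]) (rule that)
  obtain T where T: "\<And>Q. Q \<in> S \<Longrightarrow> T + Q \<in> PP"
    using ex_PP_translate[OF S] by blast
  have "finite ((+) T ` S)" "(+) T ` S \<subseteq> PP" using S T by auto
  then have "\<exists>a\<in>pos_nats. \<exists>x\<in>pos_nats. \<forall>P\<in>(+) T ` S. int a + poly P (int x) \<in> int ` A"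
    using spec[OF conjunct2[OF rich[unfolded PP_rich_def]], of "(+) T ` S"]
    by (simp only: simp_thms)
  then obtain a x where ax: "a \<in> pos_nats" "x \<in> pos_nats"
    "\<And>Q. Q \<in> S \<Longrightarrow> int a + poly (T + Q) (int x) \<in> int ` A"
    by (auto simp only: ball_simps)
  \<comment> \<open>Polynomials outside \<open>S\<close> get the spare colour 0, hence
    \<open>Suc r\<close> colours.\<close>
  define c where "c Q = (if Q \<in> S then
      SOME i. i \<in> {1..r} \<and> int a + poly (T + Q) (int x) \<in> int ` B i else 0)" for Q
  have c: "c Q \<in> {1..r} \<and> int a + poly (T + Q) (int x) \<in> int ` B (c Q)" if "Q \<in> S" for Q
  proof -
    have "\<exists>i. i \<in> {1..r} \<and> int a + poly (T + Q) (int x) \<in> int ` B i"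
      using ax(3)[OF that] A by blast
    from someI_ex[OF this] show ?thesis using that by (simp add: c_def)
  qed
  have "c Q < Suc r" for Q
    using c[of Q] by (cases "Q \<in> S") (auto simp: c_def)
  then have "range c \<subseteq> {..<Suc r}" by blast
  from mono[OF this] obtain Q n where n: "n \<ge> 1" and Q: "Q \<in> S"
    and PQ: "\<And>P. P \<in> G \<Longrightarrow> Q + pcompose P [:0, of_nat n:] \<in> S
        \<and> c (Q + pcompose P [:0, of_nat n:]) = c Q"
    by blast
  from c[OF Q] obtain b where b: "b \<in> B (c Q)" "int b = int a + poly (T + Q) (int x)"
    and i: "c Q \<in> {1..r}" by auto
  have "b \<in> pos_nats" using b i A pos by blast
  \<comment> \<open>Evaluating P(n x) at the fixed \<open>x\<close> is evaluating \<open>P\<close>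
    at the number \<open>n * x\<close>, so the pair \<open>b\<close>, \<open>n * x\<close>
    contradicts the choice of \<open>F (c Q)\<close>.\<close>
  moreover have "n * x \<in> pos_nats" using n ax by simp
  ultimately obtain P where P: "P \<in> F (c Q)" "int b + poly P (int (n * x)) \<notin> int ` B (c Q)"
    using bad[OF i] by blast
  then have "P \<in> G" using i by (auto simp: G_def)
  have "int a + poly (T + (Q + pcompose P [:0, of_nat n:])) (int x) \<in> int ` B (c Q)"
    using c[of "Q + pcompose P [:0, of_nat n:]"] PQ[OF \<open>P \<in> G\<close>] by simp
  then show False using P(2) b(2) by (simp add: poly_pcompose algebra_simps)
qed

end
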